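(* For every finite graph $G$, the set of friendly separations of $G$ is nested.
   Context: A separation of a graph $G$ is a set $\{A,B\}$ with $A\cup B=V(G)$ such that $G$ has no edge between $A\setminus B$ and $B\setminus A$; its order is $|A\cap B|$; it is proper if $A\setminus B,B\setminus A\neq\emptyset$. Two separations $\{A,B\},\{C,D\}$ are nested if, after possibly renaming sides, $A\subseteq C$ and $B\supseteq D$; otherwise they cross. A set of separations is nested if its elements are pairwise nested. For crossing $\{A,B\},\{C,D\}$ the four corners are $\{A\cap C,B\cup D\}$, $\{A\cap D,B\cup C\}$, $\{B\cap D,A\cup C\}$, $\{B\cap C,A\cup D\}$; the first two lie on the same side of $\{A,B\}$, as do the last two. An entanglement in $G$ is a non-empty set $\varepsilon$ of proper separations such that: if $\{A,B\}\in\varepsilon$ is crossed by a separation of $G$ so that two corners lying on the same side of $\{A,B\}$ have order at most $|A\cap B|$, then at least one of them has order equal to $|A\cap B|$ and lies in $\varepsilon$. A separation $s$ is friendly if it lies in some entanglement $\varepsilon$ in $G$ such that no other separation in $\varepsilon$ crosses fewer separations than $s$, where only separations lying in (at least one) entanglement in $G$ are counted. *)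

theory Defs
  imports "Graph_Theory.Digraph"
begin

text \<open>
  Finite simple graphs are the library's \<^locale>\<open>graph\<close>s, that is, finite, loopfree, symmetric
  digraphs without parallel arcs; \<open>u \<rightarrow>\<^bsub>G\<^esub> v\<close> is adjacency. A separation is the unordered
  pair \<open>{A, B}\<close> of its sides, of type \<^typ>\<open>'a set set\<close>.
\<close>

definition separation :: "('a, 'b) pre_digraph \<Rightarrow> 'a set set \<Rightarrow> bool" where
  "separation G s \<longleftrightarrow> (\<exists>A B. s = {A, B} \<and> A \<union> B = verts G \<and>
     (\<forall>u \<in> A - B. \<forall>v \<in> B - A. \<not> u \<rightarrow>\<^bsub>G\<^esub> v))"

(* For s = {A, B} the intersection of all members of s is the separator of A and B. *)
definition sep_order :: "'a set set \<Rightarrow> nat" where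
  "sep_order s = card (\<Inter> s)"

definition proper_separation :: "('a, 'b) pre_digraph \<Rightarrow> 'a set set \<Rightarrow> bool" where
  "proper_separation G s \<longleftrightarrow> separation G s \<and>
     (\<exists>A B. s = {A, B} \<and> A - B \<noteq> {} \<and> B - A \<noteq> {})"

(* The existential quantifiers range over both namings of the sides of s and of t. *)
definition nested :: "'a set set \<Rightarrow> 'a set set \<Rightarrow> bool" where
  "nested s t \<longleftrightarrow> (\<exists>A B C D. s = {A, B} \<and> t = {C, D} \<and> A \<subseteq> C \<and> D \<subseteq> B)"

abbreviation crosses :: "'a set set \<Rightarrow> 'a set set \<Rightarrow> bool" where
  "crosses s t \<equiv> \<not> nested s t"

definition nested_set :: "'a set set set \<Rightarrow> bool" where
  "nested_set S \<longleftrightarrow> (\<forall>s \<in> S. \<forall>t \<in> S. nested s t)"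

definition corner :: "'a set \<Rightarrow> 'a set \<Rightarrow> 'a set \<Rightarrow> 'a set \<Rightarrow> 'a set set" where
  "corner A B C D = {A \<inter> C, B \<union> D}"

(* corner A B C D and corner A B D C lie on the same side of {A, B}, the A-side. As A and B are
   universally quantified and {A, B} = {B, A}, the condition also covers the two corners on the
   B-side. *)
definition entanglement :: "('a, 'b) pre_digraph \<Rightarrow> 'a set set set \<Rightarrow> bool" where
  "entanglement G \<epsilon> \<longleftrightarrow> \<epsilon> \<noteq> {} \<and> (\<forall>s \<in> \<epsilon>. proper_separation G s) \<and>
     (\<forall>A B C D. {A, B} \<in> \<epsilon> \<longrightarrow> separation G {C, D} \<longrightarrow> crosses {C, D} {A, B} \<longrightarrow>
        (\<forall>c \<in> {corner A B C D, corner A B D C}. sep_order c \<le> sep_order {A, B}) \<longrightarrow>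
        (\<exists>c \<in> {corner A B C D, corner A B D C}. sep_order c = sep_order {A, B} \<and> c \<in> \<epsilon>))"

definition crossing_number :: "('a, 'b) pre_digraph \<Rightarrow> 'a set set \<Rightarrow> nat" where
  "crossing_number G s = card {t. (\<exists>\<epsilon>. entanglement G \<epsilon> \<and> t \<in> \<epsilon>) \<and> crosses s t}"

definition friendly :: "('a, 'b) pre_digraph \<Rightarrow> 'a set set \<Rightarrow> bool" where
  "friendly G s \<longleftrightarrow> separation G s \<and> (\<exists>\<epsilon>. entanglement G \<epsilon> \<and> s \<in> \<epsilon> \<and>
     \<not> (\<exists>t \<in> \<epsilon>. crossing_number G t < crossing_number G s))"

end

theory Submission
  imports Defs Complex_Main
begin

text \<open>
  Suppose that friendly separations \<open>s\<close> and \<open>t\<close>, witnessed by entanglements \<open>\<epsilon>\<close> and \<open>\<eta>\<close>, cross.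
  The orders of two opposite corners of \<open>s\<close> and \<open>t\<close> sum to \<open>|s| + |t|\<close>, while their crossing numbers
  sum to strictly less than those of \<open>s\<close> and \<open>t\<close>: a separation crossing a corner crosses \<open>s\<close> or \<open>t\<close>,
  one crossing two opposite corners crosses both, and \<open>s\<close> and \<open>t\<close> themselves cross no corner.
  By minimality, no corner in \<open>\<epsilon>\<close> can therefore be opposite to a corner in \<open>\<eta>\<close>. Comparing orders,
  the entanglement conditions for \<open>\<epsilon>\<close> and \<open>\<eta>\<close> leave only the case that \<open>\<epsilon>\<close> contains one pair of
  opposite corners and \<open>\<eta>\<close> the other. Adding the two inequalities for crossing numbers then gives a
  contradiction.
\<close>

lemma nested_doubleton_iff:
  "nested {A, B} {C, D} \<longleftrightarrow>
     A \<subseteq> C \<and> D \<subseteq> B \<or> A \<subseteq> D \<and> C \<subseteq> B \<or> B \<subseteq> C \<and> D \<subseteq> A \<or> B \<subseteq> D \<and> C \<subseteq> A"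
  unfolding nested_def doubleton_eq_iff by blast

lemma nested_sym: "nested s t \<Longrightarrow> nested t s"
  unfolding nested_def by (metis insert_commute)

lemma corner_commute: "corner C D A B = corner A B C D"
  by (simp add: corner_def Int_commute Un_commute)

text \<open>Suppose \<open>{E, F}\<close> is nested with both. If this puts \<open>A\<close> or
  \<open>C\<close> inside a side of \<open>{E, F}\<close>, then \<open>A \<inter> C\<close> lies
  there too. Otherwise it puts \<open>B\<close> and \<open>D\<close> inside sides: if the same one,
  it contains \<open>B \<union> D\<close>; if different ones, \<open>{A, B}\<close> and
  \<open>{C, D}\<close> are nested.\<close>

lemma crosses_corner:
  assumes "crosses {A, B} {C, D}" and "crosses (corner A B C D) {E, F}"
  shows "crosses {A, B} {E, F} \<or> crosses {C, D} {E, F}"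
proof (rule ccontr)
  assume "\<not> ?thesis"
  then have "nested {A, B} {E, F}" "nested {C, D} {E, F}"
    by simp_all
  then have "nested {A, B} {C, D} \<or> nested (corner A B C D) {E, F}"
    unfolding corner_def nested_doubleton_iff
    by (elim disjE conjE) (simp add: le_infI1 le_infI2 le_supI1 le_supI2; meson subset_trans)+
  then show False
    using assms by blast
qed

text \<open>Nestedness with \<open>{A, B}\<close> puts \<open>A\<close> or \<open>B\<close> inside a
  side of \<open>{E, F}\<close>. Shrinking it to \<open>A \<inter> C\<close> or
  \<open>B \<inter> D\<close> while the other side grows preserves this. The same works for
  \<open>{C, D}\<close>.\<close>

lemma crosses_opposite_corners:
  assumes "crosses (corner A B C D) {E, F}" and "crosses (corner B A D C) {E, F}"
  shows "crosses {A, B} {E, F}" and "crosses {C, D} {E, F}"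
proof -
  have "nested (corner A B C D) {E, F} \<or> nested (corner B A D C) {E, F}"
    if "nested {A, B} {E, F} \<or> nested {C, D} {E, F}"
    using that unfolding corner_def nested_doubleton_iff
    by (elim disjE conjE) (simp_all add: le_infI1 le_infI2 le_supI1 le_supI2)
  then show "crosses {A, B} {E, F}" "crosses {C, D} {E, F}"
    using assms by blast+
qed

lemma nested_corner: "nested (corner A B C D) {A, B}"
  unfolding corner_def nested_doubleton_iff by blast

lemma sep_order_opposite_corners:
  assumes "finite (A \<union> B)" and "A \<union> B = C \<union> D"
  shows "sep_order (corner A B C D) + sep_order (corner B A D C) =
         sep_order {A, B} + sep_order {C, D}"
proof -
  let ?X = "A \<inter> C \<inter> (B \<union> D)" and ?Y = "B \<inter> D \<inter> (A \<union> C)"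
  have fin: "finite A" "finite B" "finite C" "finite D"
    using assms by (metis finite_Un)+
  have "card ?X + card ?Y = card (?X \<union> ?Y) + card (?X \<inter> ?Y)"
    using fin by (intro card_Un_Int) auto
  \<comment> \<open>As \<open>A \<union> B = C \<union> D\<close>, each point of
    \<open>A \<inter> B\<close> lies in \<open>C\<close> or \<open>D\<close>, hence in
    \<open>?X\<close> or \<open>?Y\<close>; likewise for \<open>C \<inter> D\<close>.\<close>
  also have "?X \<union> ?Y = (A \<inter> B) \<union> (C \<inter> D)"
    using assms(2) by blast
  also have "?X \<inter> ?Y = (A \<inter> B) \<inter> (C \<inter> D)"
    by blast
  also have "card ((A \<inter> B) \<union> (C \<inter> D)) + card ((A \<inter> B) \<inter> (C \<inter> D)) =
      card (A \<inter> B) + card (C \<inter> D)"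
    using fin by (intro card_Un_Int[symmetric]) auto
  finally show ?thesis
    by (simp add: sep_order_def corner_def)
qed

lemma entanglement_separation:
  "entanglement G \<epsilon> \<Longrightarrow> s \<in> \<epsilon> \<Longrightarrow> separation G s"
  by (simp add: entanglement_def proper_separation_def)

lemma entanglement_corner:
  assumes "entanglement G \<epsilon>" and "{A, B} \<in> \<epsilon>" and "separation G {C, D}"
    and "crosses {A, B} {C, D}"
    and "sep_order (corner A B C D) \<le> sep_order {A, B}"
    and "sep_order (corner A B D C) \<le> sep_order {A, B}"
  shows "sep_order (corner A B C D) = sep_order {A, B} \<and> corner A B C D \<in> \<epsilon> \<or>
         sep_order (corner A B D C) = sep_order {A, B} \<and> corner A B D C \<in> \<epsilon>"
proof -
  have "crosses {C, D} {A, B}"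
    using assms(4) nested_sym by blast
  then show ?thesis
    using assms unfolding entanglement_def by blast
qed

text \<open>
  Order bookkeeping: \<open>\<sigma>\<close>, \<open>\<tau>\<close> and \<open>o\<^sub>i\<^sub>j\<close> are the orders of the two separations and their corners, where
  \<open>o\<^sub>i\<^sub>j\<close> with equal first (second) index lie on the same side of the first (second) separation;
  \<open>e\<^sub>i\<^sub>j\<close> and \<open>h\<^sub>i\<^sub>j\<close> say that the corner lies in the first and second entanglement.
\<close>
lemma corner_orders_contradiction:
  fixes \<sigma> \<tau> o11 o12 o21 o22 :: real
  assumes "o11 + o22 = \<sigma> + \<tau>" and "o12 + o21 = \<sigma> + \<tau>"
    and "o11 \<le> \<sigma> \<and> o12 \<le> \<sigma> \<longrightarrow> o11 = \<sigma> \<and> e11 \<or> o12 = \<sigma> \<and> e12"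
    and "o21 \<le> \<sigma> \<and> o22 \<le> \<sigma> \<longrightarrow> o21 = \<sigma> \<and> e21 \<or> o22 = \<sigma> \<and> e22"
    and "o11 \<le> \<tau> \<and> o21 \<le> \<tau> \<longrightarrow> o11 = \<tau> \<and> h11 \<or> o21 = \<tau> \<and> h21"
    and "o12 \<le> \<tau> \<and> o22 \<le> \<tau> \<longrightarrow> o12 = \<tau> \<and> h12 \<or> o22 = \<tau> \<and> h22"
    and "\<not> (e11 \<and> h22)" "\<not> (e22 \<and> h11)" "\<not> (e12 \<and> h21)" "\<not> (e21 \<and> h12)"
    and "\<not> (e11 \<and> e22 \<and> h12 \<and> h21)" "\<not> (e12 \<and> e21 \<and> h11 \<and> h22)"
  shows False
  \<comment> \<open>If all six orders agree, every implication fires: \<open>e11\<close> forces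
    \<open>h12\<close>, \<open>e22\<close>, \<open>h21\<close> in turn, and \<open>e12\<close>
    forces \<open>h11\<close>, \<open>e21\<close>, \<open>h22\<close>. In any other order pattern,
    the implications clash with the orders or with the exclusions on opposite corners.\<close>
  using assms by argo

context
  fixes G :: "('a, 'b) pre_digraph"
  assumes fin: "finite (verts G)"
begin

text \<open>Ensures that \<open>card\<close> in \<open>crossing_number\<close> is a true count and
  not the default 0.\<close>

lemma finite_entangled: "finite {t. (\<exists>\<epsilon>. entanglement G \<epsilon> \<and> t \<in> \<epsilon>) \<and> P t}"
proof (rule finite_subset)
  show "{t. (\<exists>\<epsilon>. entanglement G \<epsilon> \<and> t \<in> \<epsilon>) \<and> P t} \<subseteq> Pow (Pow (verts G))"
    using entanglement_separation unfolding separation_def by blast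
  show "finite (Pow (Pow (verts G)))"
    using fin by simp
qed

lemma crossing_number_opposite_corners:
  assumes "entanglement G \<epsilon>" "{A, B} \<in> \<epsilon>" and cross: "crosses {A, B} {C, D}"
  shows "crossing_number G (corner A B C D) + crossing_number G (corner B A D C) <
         crossing_number G {A, B} + crossing_number G {C, D}"
proof -
  define N where "N s = {t. (\<exists>\<epsilon>. entanglement G \<epsilon> \<and> t \<in> \<epsilon>) \<and> crosses s t}" for s
  have finN: "finite (N s)" for s
    unfolding N_def by (rule finite_entangled)
  let ?c = "corner A B C D" and ?d = "corner B A D C"
  have pair: "\<exists>E F. t = {E, F}" if "t \<in> N s" for s t
  proof -
    have "separation G t"
      using that entanglement_separation by (auto simp: N_def)
    then show ?thesis
      by (auto simp: separation_def)
  qed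
  have swap: "{B, A} = {A, B}" "{D, C} = {C, D}"
    by blast+
  then have cross': "crosses {B, A} {D, C}"
    using cross by simp
  have sub: "N ?c \<union> N ?d \<subseteq> N {A, B} \<union> N {C, D}"
  proof
    fix t
    assume t: "t \<in> N ?c \<union> N ?d"
    then obtain E F where "t = {E, F}"
      by (metis pair UnE)
    then show "t \<in> N {A, B} \<union> N {C, D}"
      using t crosses_corner[OF cross, of E F] crosses_corner[OF cross', of E F, unfolded swap]
      by (simp add: N_def) blast
  qed
  have sub': "N ?c \<inter> N ?d \<subseteq> N {A, B} \<inter> N {C, D}"
  proof
    fix t
    assume t: "t \<in> N ?c \<inter> N ?d"
    then obtain E F where "t = {E, F}"
      by (metis pair IntE)
    then show "t \<in> N {A, B} \<inter> N {C, D}"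
      using t crosses_opposite_corners[of A B C D E F] by (simp add: N_def)
  qed
  have "nested ?c {A, B}" "nested ?d {A, B}"
    using nested_corner[of A B C D] nested_corner[of B A D C, unfolded swap] by simp_all
  then have "{A, B} \<notin> N ?c \<union> N ?d"
    by (simp add: N_def)
  \<comment> \<open>The source of strictness: \<open>{A, B}\<close> is counted because it lies in
    \<open>\<epsilon>\<close>, yet it crosses neither corner.\<close>
  moreover have "{A, B} \<in> N {C, D}"
    using assms nested_sym by (auto simp: N_def)
  ultimately have "N ?c \<union> N ?d \<subset> N {A, B} \<union> N {C, D}"
    using sub by blast
  then have "card (N ?c \<union> N ?d) < card (N {A, B} \<union> N {C, D})"
    by (intro psubset_card_mono) (simp_all add: finN)
  moreover have "card (N ?c \<inter> N ?d) \<le> card (N {A, B} \<inter> N {C, D})"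
    by (intro card_mono sub') (simp add: finN)
  ultimately have "card (N ?c) + card (N ?d) < card (N {A, B}) + card (N {C, D})"
    by (simp add: card_Un_Int[OF finN finN])
  then show ?thesis
    by (simp add: crossing_number_def N_def)
qed

lemma friendly_nested:
  assumes "friendly G s" and "friendly G t"
  shows "nested s t"
proof (rule ccontr)
  assume cross: "crosses s t"
  obtain A B where s: "s = {A, B}" "A \<union> B = verts G"
    using assms(1) unfolding friendly_def separation_def by blast
  obtain C D where t: "t = {C, D}" "C \<union> D = verts G"
    using assms(2) unfolding friendly_def separation_def by blast
  obtain \<epsilon> where \<epsilon>: "entanglement G \<epsilon>" "s \<in> \<epsilon>"
    and min\<epsilon>: "\<And>r. r \<in> \<epsilon> \<Longrightarrow> crossing_number G s \<le> crossing_number G r"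
    using assms(1) unfolding friendly_def by (meson not_less)
  obtain \<eta> where \<eta>: "entanglement G \<eta>" "t \<in> \<eta>"
    and min\<eta>: "\<And>r. r \<in> \<eta> \<Longrightarrow> crossing_number G t \<le> crossing_number G r"
    using assms(2) unfolding friendly_def by (meson not_less)
  \<comment> \<open>The first index selects \<open>A\<close> or \<open>B\<close>, the second
    \<open>C\<close> or \<open>D\<close>, so opposite corners differ in both indices.\<close>
  define c11 c12 c21 c22 where c:
    "c11 = corner A B C D" "c12 = corner A B D C" "c21 = corner B A C D" "c22 = corner B A D C"
  have sep: "separation G s" "separation G t"
    using assms by (simp_all add: friendly_def)
  have swap: "{B, A} = s" "{D, C} = t"
    by (auto simp: s t)

  have orders: "sep_order c11 + sep_order c22 = sep_order s + sep_order t"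
    "sep_order c12 + sep_order c21 = sep_order s + sep_order t"
    using sep_order_opposite_corners[of A B C D] sep_order_opposite_corners[of A B D C] fin s(2) t(2)
    by (simp_all add: s(1) t(1) c Un_commute insert_commute)
  have crossings:
    "crossing_number G c11 + crossing_number G c22 < crossing_number G s + crossing_number G t"
    "crossing_number G c12 + crossing_number G c21 < crossing_number G s + crossing_number G t"
    using crossing_number_opposite_corners[OF \<epsilon>(1), of A B C D]
      crossing_number_opposite_corners[OF \<epsilon>(1), of A B D C] \<epsilon>(2) cross
    by (simp_all add: s(1) t(1) c insert_commute)

  have \<epsilon>_corners:
    "sep_order c11 = sep_order s \<and> c11 \<in> \<epsilon> \<or> sep_order c12 = sep_order s \<and> c12 \<in> \<epsilon>"
    if "sep_order c11 \<le> sep_order s" "sep_order c12 \<le> sep_order s"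
    using entanglement_corner[OF \<epsilon>(1), of A B C D] that \<epsilon>(2) sep(2) cross
    by (simp add: s(1) t(1) c)
  have \<epsilon>_corners':
    "sep_order c21 = sep_order s \<and> c21 \<in> \<epsilon> \<or> sep_order c22 = sep_order s \<and> c22 \<in> \<epsilon>"
    if "sep_order c21 \<le> sep_order s" "sep_order c22 \<le> sep_order s"
    using entanglement_corner[OF \<epsilon>(1), of B A C D] that \<epsilon>(2) sep(2) cross
    by (simp add: swap t(1)[symmetric] c)
  have cross': "crosses t s"
    using cross nested_sym by blast
  have \<eta>_corners:
    "sep_order c11 = sep_order t \<and> c11 \<in> \<eta> \<or> sep_order c21 = sep_order t \<and> c21 \<in> \<eta>"
    if "sep_order c11 \<le> sep_order t" "sep_order c21 \<le> sep_order t"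
    using entanglement_corner[OF \<eta>(1), of C D A B] that \<eta>(2) sep(1) cross'
    by (simp add: s(1) t(1) c corner_commute[of C D])
  have \<eta>_corners':
    "sep_order c12 = sep_order t \<and> c12 \<in> \<eta> \<or> sep_order c22 = sep_order t \<and> c22 \<in> \<eta>"
    if "sep_order c12 \<le> sep_order t" "sep_order c22 \<le> sep_order t"
    using entanglement_corner[OF \<eta>(1), of D C A B] that \<eta>(2) sep(1) cross'
    by (simp add: swap s(1)[symmetric] c corner_commute[of D C])

  show False
  \<comment> \<open>The orders enter as reals; the unfolding returns the arithmetic premises to
    \<open>nat\<close>.\<close>
  proof (rule corner_orders_contradiction[where
        \<sigma> = "sep_order s" and \<tau> = "sep_order t" and
        ?o11.0 = "sep_order c11" and ?o12.0 = "sep_order c12" and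
        ?o21.0 = "sep_order c21" and ?o22.0 = "sep_order c22" and
        ?e11.0 = "c11 \<in> \<epsilon>" and ?e12.0 = "c12 \<in> \<epsilon>" and ?e21.0 = "c21 \<in> \<epsilon>" and ?e22.0 = "c22 \<in> \<epsilon>" and
        ?h11.0 = "c11 \<in> \<eta>" and ?h12.0 = "c12 \<in> \<eta>" and ?h21.0 = "c21 \<in> \<eta>" and ?h22.0 = "c22 \<in> \<eta>"],
      unfold of_nat_add[symmetric] of_nat_eq_iff of_nat_le_iff)
    show "\<not> (c11 \<in> \<epsilon> \<and> c22 \<in> \<eta>)"
      using crossings min\<epsilon>[of c11] min\<eta>[of c22] by linarith
    show "\<not> (c22 \<in> \<epsilon> \<and> c11 \<in> \<eta>)"
      using crossings min\<epsilon>[of c22] min\<eta>[of c11] by linarith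
    show "\<not> (c12 \<in> \<epsilon> \<and> c21 \<in> \<eta>)"
      using crossings min\<epsilon>[of c12] min\<eta>[of c21] by linarith
    show "\<not> (c21 \<in> \<epsilon> \<and> c12 \<in> \<eta>)"
      using crossings min\<epsilon>[of c21] min\<eta>[of c12] by linarith
    show "\<not> (c11 \<in> \<epsilon> \<and> c22 \<in> \<epsilon> \<and> c12 \<in> \<eta> \<and> c21 \<in> \<eta>)"
      using crossings min\<epsilon>[of c11] min\<epsilon>[of c22] min\<eta>[of c12] min\<eta>[of c21] by linarith
    show "\<not> (c12 \<in> \<epsilon> \<and> c21 \<in> \<epsilon> \<and> c11 \<in> \<eta> \<and> c22 \<in> \<eta>)"
      using crossings min\<epsilon>[of c12] min\<epsilon>[of c21] min\<eta>[of c11] min\<eta>[of c22] by linarith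
  qed (use orders \<epsilon>_corners \<epsilon>_corners' \<eta>_corners \<eta>_corners' in blast)+
qed

end

theorem theorem3p5:
  fixes G :: "('a, 'b) pre_digraph"
  assumes "graph G"
  shows "nested_set {s. friendly G s}"
proof -
  interpret graph G
    by (fact assms)
  show ?thesis
    using friendly_nested[OF finite_verts] by (simp add: nested_set_def)
qed

end
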